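(* Let $G$ be a non-discrete totally disconnected locally compact group such that every infinite normal subgroup of $G$ has trivial centralizer in $G$. If $\Gamma$ is a dense subgroup of $G$ that is finitely generated and residually finite (as an abstract group), then the only discrete normal subgroup of $G$ contained in $\Gamma$ is the trivial subgroup.
   Context: Locally compact groups are Hausdorff topological groups. Infinite normal subgroups of $G$ are not required to be closed. *)

theory Defs
  imports "HOL-Analysis.Analysis" "HOL-Algebra.Algebra"
begin

locale topological_group = group G for G (structure) +
  fixes T :: "'a topology"
  assumes topspace_eq: "topspace T = carrier G"
    and continuous_mult: "continuous_map (prod_topology T T) T (\<lambda>(x, y). x \<otimes> y)"
    and continuous_inv: "continuous_map T T (\<lambda>x. inv\<^bsub>G\<^esub> x)"

(* The Hausdorff condition is part of the definition of a locally compact group. *)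
definition locally_compact_group :: "('a, 'b) monoid_scheme \<Rightarrow> 'a topology \<Rightarrow> bool" where
  "locally_compact_group G T \<longleftrightarrow>
     topological_group G T \<and> Hausdorff_space T \<and> locally_compact_space T"

definition totally_disconnected_space :: "'a topology \<Rightarrow> bool" where
  "totally_disconnected_space T \<longleftrightarrow>
     (\<forall>x \<in> topspace T. connected_component_of_set T x = {x})"

definition centralizer :: "('a, 'b) monoid_scheme \<Rightarrow> 'a set \<Rightarrow> 'a set" where
  "centralizer G S = {g \<in> carrier G. \<forall>x \<in> S. g \<otimes>\<^bsub>G\<^esub> x = x \<otimes>\<^bsub>G\<^esub> g}"

definition finitely_generated_group :: "('a, 'b) monoid_scheme \<Rightarrow> bool" where
  "finitely_generated_group G \<longleftrightarrow>
     group G \<and> (\<exists>S. finite S \<and> S \<subseteq> carrier G \<and> generate G S = carrier G)"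

definition residually_finite_group :: "('a, 'b) monoid_scheme \<Rightarrow> bool" where
  "residually_finite_group G \<longleftrightarrow>
     group G \<and>
     (\<forall>x \<in> carrier G. x \<noteq> \<one>\<^bsub>G\<^esub> \<longrightarrow>
        (\<exists>N. N \<lhd> G \<and> finite (carrier (G Mod N)) \<and> x \<notin> N))"

end

theory Submission
  imports Defs
begin

text \<open>Let \<open>n\<close> lie in a discrete normal subgroup \<open>N\<close> of \<open>G\<close> contained in \<open>\<Gamma>\<close>. The
  orbit map \<open>g \<mapsto> g n g\<^sup>-\<^sup>1\<close> is continuous into a discrete set, so the centralizer of \<open>n\<close> is open
  and contains a compact open subgroup \<open>U\<close> by van Dantzig's theorem. The group \<open>W = \<Gamma> \<inter> U\<close> is
  infinite and commensurated in \<open>\<Gamma>\<close>, so its profinite closure in the finitely generated group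
  \<open>\<Gamma>\<close> contains a normal subgroup \<open>M\<close> of \<open>\<Gamma>\<close> meeting \<open>W\<close> in finite index. By residual
  finiteness \<open>n\<close> centralizes the profinite closure of \<open>W\<close> and in particular \<open>M\<close>. By density
  \<open>M\<close> then centralizes the whole conjugacy class of \<open>n\<close> in \<open>G\<close>, whose centralizer is thus an
  infinite normal subgroup of \<open>G\<close>, and it commutes with \<open>n\<close>. Hence \<open>n = 1\<close>.\<close>

section \<open>Normal subgroups of finite index and the profinite closure of a subgroup\<close>

definition normal_finite_index :: "'a set \<Rightarrow> ('a, 'b) monoid_scheme \<Rightarrow> bool" where
  "normal_finite_index Q G \<longleftrightarrow> Q \<lhd> G \<and> finite (carrier (G Mod Q))"

text \<open>This is the closure of \<open>W\<close> in the topology that has the normal subgroups of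
  finite index as a neighbourhood base of the identity: \<open>x\<close> is adherent to
  \<open>W\<close> exactly if every coset \<open>Q #> x\<close> meets \<open>W\<close>.\<close>

definition profinite_closure :: "('a, 'b) monoid_scheme \<Rightarrow> 'a set \<Rightarrow> 'a set" where
  "profinite_closure G W =
     {x \<in> carrier G. \<forall>Q. normal_finite_index Q G \<longrightarrow> x \<in> Q <#>\<^bsub>G\<^esub> W}"

context group
begin

lemma mult_inv_cancel:
  assumes "x \<in> carrier G" "y \<in> carrier G"
  shows "inv x \<otimes> (x \<otimes> y) = y" "x \<otimes> (inv x \<otimes> y) = y"
  using assms by (simp_all flip: m_assoc)

lemma normal_finite_index_carrier: "normal_finite_index (carrier G) G"
proof -
  have "rcosets (carrier G) \<subseteq> {carrier G}"
    by (auto simp: RCOSETS_def coset_join2 subgroup_self)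
  then show ?thesis
    by (auto simp: normal_finite_index_def normal_self FactGroup_def intro: finite_subset)
qed

text \<open>A coset of \<open>P \<inter> Q\<close> is the intersection of a coset of
  \<open>P\<close> with a coset of \<open>Q\<close>, which leaves only finitely many.\<close>

lemma normal_finite_index_Int:
  assumes "normal_finite_index P G" "normal_finite_index Q G"
  shows "normal_finite_index (P \<inter> Q) G"
proof -
  have P: "P \<lhd> G" "finite (rcosets P)" and Q: "Q \<lhd> G" "finite (rcosets Q)"
    using assms by (auto simp: normal_finite_index_def FactGroup_def)
  then have sub: "P \<subseteq> carrier G" "Q \<subseteq> carrier G"
    by (auto dest: normal_imp_subgroup subgroup.subset)
  have eq: "(P \<inter> Q) #> x = (P #> x) \<inter> (Q #> x)" if x: "x \<in> carrier G" for x
  proof -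
    have "p = q" if "p \<in> P" "q \<in> Q" "p \<otimes> x = q \<otimes> x" for p q
      using that x sub by (metis r_cancel subsetD)
    then show ?thesis
      by (fastforce simp: r_coset_def)
  qed
  have "rcosets (P \<inter> Q) \<subseteq> (\<lambda>(A, B). A \<inter> B) ` ((rcosets P) \<times> (rcosets Q))"
    by (force simp: RCOSETS_def eq)
  then have "finite (rcosets (P \<inter> Q))"
    using P Q by (meson finite_SigmaI finite_imageI finite_subset)
  then show ?thesis
    using P Q by (simp add: normal_finite_index_def FactGroup_def normal_subgroup_intersect)
qed

lemma normal_finite_index_Inter:
  assumes "finite I" "\<And>i. i \<in> I \<Longrightarrow> normal_finite_index (Q i) G"
  shows "\<exists>P. normal_finite_index P G \<and> (\<forall>i\<in>I. P \<subseteq> Q i)"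
  using assms
proof (induction I)
  case empty
  then show ?case using normal_finite_index_carrier by blast
next
  case (insert i I)
  then obtain P where "normal_finite_index P G" "\<forall>i\<in>I. P \<subseteq> Q i" by auto
  then show ?case
    using insert.prems normal_finite_index_Int[of P "Q i"] by (intro exI[of _ "P \<inter> Q i"]) auto
qed

text \<open>By the pigeonhole principle some coset of \<open>Q\<close> contains infinitely many
  elements of \<open>W\<close>; multiplying them by the inverse of one of them moves them
  injectively into \<open>Q \<inter> W\<close>.\<close>

lemma infinite_Int_normal_finite_index:
  assumes Q: "normal_finite_index Q G" and W: "subgroup W G" "infinite W"
  shows "infinite (Q \<inter> W)"
proof
  assume fin: "finite (Q \<inter> W)"
  have sQ: "subgroup Q G" and fQ: "finite (rcosets Q)"
    using Q by (auto simp: normal_finite_index_def FactGroup_def normal_imp_subgroup)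
  have Wc: "W \<subseteq> carrier G" using W subgroup.subset by blast
  have "(\<lambda>w. Q #> w) ` W \<subseteq> rcosets Q"
    using Wc by (auto simp: RCOSETS_def)
  then obtain A where A: "infinite ((\<lambda>w. Q #> w) -` {A} \<inter> W)"
    using inf_img_fin_dom'[of "\<lambda>w. Q #> w" W] fQ W(2) finite_subset by blast
  define B where "B = (\<lambda>w. Q #> w) -` {A} \<inter> W"
  obtain b where b: "b \<in> B" using A by (metis B_def finite.emptyI ex_in_conv)
  have "(\<lambda>w. w \<otimes> inv b) ` B \<subseteq> Q \<inter> W"
  proof safe
    fix w assume w: "w \<in> B"
    have wc: "w \<in> carrier G" "b \<in> carrier G" using w b Wc by (auto simp: B_def)
    have "w \<in> Q #> w" using rcos_self[OF wc(1) sQ] .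
    also have "Q #> w = Q #> b" using w b by (simp add: B_def)
    finally show "w \<otimes> inv b \<in> Q"
      using wc sQ by (metis subgroup.rcos_module_imp is_group)
    show "w \<otimes> inv b \<in> W"
      using w b W by (auto simp: B_def subgroup.m_closed subgroup.m_inv_closed)
  qed
  moreover have "inj_on (\<lambda>w. w \<otimes> inv b) B"
    using b Wc by (intro inj_onI) (metis B_def IntD2 inv_closed r_cancel subsetD)
  ultimately show False
    using A fin by (metis B_def finite_imageD finite_subset)
qed

lemma profinite_closure_subset: "W \<subseteq> carrier G \<Longrightarrow> W \<subseteq> profinite_closure G W"
proof
  fix w assume W: "W \<subseteq> carrier G" and w: "w \<in> W"
  have "w \<in> Q <#> W" if "normal_finite_index Q G" for Q
  proof -
    have "\<one> \<in> Q"
      using that by (simp add: normal_finite_index_def normal_imp_subgroup subgroup.one_closed)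
    then show ?thesis
      using W w unfolding set_mult_def by force
  qed
  then show "w \<in> profinite_closure G W"
    using W w by (auto simp: profinite_closure_def)
qed

lemma subgroup_set_mult_normal_finite_index:
  "normal_finite_index Q G \<Longrightarrow> subgroup W G \<Longrightarrow> subgroup (Q <#> W) G"
  by (simp add: mult_norm_subgroup normal_finite_index_def)

lemma subgroup_profinite_closure:
  assumes W: "subgroup W G"
  shows "subgroup (profinite_closure G W) G"
proof (rule subgroupI)
  note sub = subgroup_set_mult_normal_finite_index[OF _ W]
  show "profinite_closure G W \<subseteq> carrier G" by (auto simp: profinite_closure_def)
  show "profinite_closure G W \<noteq> {}"
    using profinite_closure_subset[OF subgroup.subset[OF W]] subgroup.one_closed[OF W] by auto
  show "inv a \<in> profinite_closure G W" if "a \<in> profinite_closure G W" for a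
    using that sub by (auto simp: profinite_closure_def subgroup.m_inv_closed)
  show "a \<otimes> b \<in> profinite_closure G W"
    if "a \<in> profinite_closure G W" "b \<in> profinite_closure G W" for a b
    using that sub by (auto simp: profinite_closure_def subgroup.m_closed)
qed

text \<open>Each point of \<open>D\<close> outside the closure is excluded by some
  \<open>Q d\<close>; the intersection of these finitely many subgroups excludes all of them at
  once.\<close>

lemma separate_finite_from_profinite_closure:
  assumes "finite D" "D \<subseteq> carrier G"
  shows "\<exists>Q. normal_finite_index Q G \<and> D \<inter> (Q <#> W) \<subseteq> profinite_closure G W"
proof -
  have "\<exists>Q. normal_finite_index Q G \<and> (d \<in> Q <#> W \<longrightarrow> d \<in> profinite_closure G W)"
    if "d \<in> D" for d
    using that assms normal_finite_index_carrier by (auto simp: profinite_closure_def)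
  then obtain Q where Q: "\<And>d. d \<in> D \<Longrightarrow> normal_finite_index (Q d) G"
      "\<And>d. d \<in> D \<Longrightarrow> d \<in> Q d <#> W \<Longrightarrow> d \<in> profinite_closure G W"
    by metis
  obtain P where P: "normal_finite_index P G" "\<forall>d\<in>D. P \<subseteq> Q d"
    using normal_finite_index_Inter[of D Q] assms(1) Q(1) by blast
  then have "D \<inter> (P <#> W) \<subseteq> profinite_closure G W"
    using Q(2) mono_set_mult by fast
  then show ?thesis using P by blast
qed

section \<open>Commensurated subgroups of finitely generated groups\<close>

text \<open>The condition is imposed on the inverses of the generators as well, because a conjugate
  of an infinite subgroup may be properly contained in it.\<close>

lemma normal_if_generators_normalize:
  assumes M: "subgroup M G" and S: "S \<subseteq> carrier G" "generate G S = carrier G"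
    and norm: "\<And>s x. s \<in> S \<union> m_inv G ` S \<Longrightarrow> x \<in> M \<Longrightarrow> s \<otimes> x \<otimes> inv s \<in> M"
  shows "M \<lhd> G"
proof (rule normal_invI[OF M])
  fix g h assume g: "g \<in> carrier G" and h: "h \<in> M"
  have Mc: "\<And>x. x \<in> M \<Longrightarrow> x \<in> carrier G" using M subgroup.mem_carrier by fast
  have "g \<in> generate G S" using g S by simp
  then have "g \<in> carrier G \<and> (\<forall>x\<in>M. g \<otimes> x \<otimes> inv g \<in> M)"
  proof (induction rule: generate.induct)
    case one
    then show ?case using Mc by simp
  next
    case (incl s)
    then show ?case using S norm by blast
  next
    case (inv s)
    then show ?case using S norm by blast
  next
    case (eng a b)
    then have "a \<otimes> b \<otimes> x \<otimes> inv (a \<otimes> b) = a \<otimes> (b \<otimes> x \<otimes> inv b) \<otimes> inv a" if "x \<in> M" for x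
      using that Mc by (simp add: m_assoc inv_mult_group)
    then show ?case using eng by simp
  qed
  then show "g \<otimes> h \<otimes> inv g \<in> M" using h by blast
qed

text \<open>The right cosets of the profinite closure of \<open>W\<close> are the vertices of a locally finite
  connected graph. Choose \<open>Q\<close> so small that it moves no vertex by distance one or two. Then the
  stabilizer in \<open>Q\<close> of a vertex fixes all neighbours of that vertex, hence every vertex, so it
  is normal. The finite sets \<open>F s\<close> below describe the neighbours of the base vertex.\<close>

lemma commensurated_virtually_normal:
  assumes W: "subgroup W G"
    and S: "finite S" "S \<subseteq> carrier G" "generate G S = carrier G"
    and comm: "\<And>g. g \<in> carrier G \<Longrightarrow>
      \<exists>F. finite F \<and> F \<subseteq> carrier G \<and> (\<forall>w\<in>W. \<exists>f\<in>F. g \<otimes> w \<otimes> inv f \<in> W)"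
  shows "\<exists>Q. normal_finite_index Q G \<and> Q \<inter> profinite_closure G W \<lhd> G"
proof -
  let ?C = "profinite_closure G W"
  define S' where "S' = S \<union> m_inv G ` S"
  have Sc: "S' \<subseteq> carrier G" using S by (auto simp: S'_def)
  obtain F where F: "\<And>g. g \<in> carrier G \<Longrightarrow> finite (F g)"
      "\<And>g. g \<in> carrier G \<Longrightarrow> F g \<subseteq> carrier G"
      "\<And>g w. g \<in> carrier G \<Longrightarrow> w \<in> W \<Longrightarrow> \<exists>f\<in>F g. g \<otimes> w \<otimes> inv f \<in> W"
    using comm by metis
  \<comment> \<open>Elements \<open>f\<close> and \<open>f'\<close> represent the same right coset
    of \<open>?C\<close> exactly if \<open>f \<otimes> inv f'\<close> lies in \<open>?C\<close>. The
    \<open>Q\<close> obtained from \<open>D\<close> therefore cannot carry one neighbour of the base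
    vertex to a different one.\<close>
  define D where "D = (\<Union>s\<in>S'. (\<lambda>(f, f'). f \<otimes> inv f') ` (F s \<times> F s))"
  have "finite D" unfolding D_def using S Sc F(1) by (intro finite_UN_I) (auto simp: S'_def)
  moreover have "D \<subseteq> carrier G"
  proof -
    have "f \<otimes> inv f' \<in> carrier G" if "s \<in> S'" "f \<in> F s" "f' \<in> F s" for s f f'
      using that F(2)[of s] Sc by (meson inv_closed m_closed subsetD)
    then show ?thesis by (auto simp: D_def)
  qed
  ultimately obtain Q where Q: "normal_finite_index Q G" and QD: "D \<inter> (Q <#> W) \<subseteq> ?C"
    using separate_finite_from_profinite_closure by blast
  have C: "subgroup ?C G" using subgroup_profinite_closure[OF W] .
  have Qn: "Q \<lhd> G" and Qs: "subgroup Q G"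
    using Q by (auto simp: normal_finite_index_def normal_imp_subgroup)
  have Wc: "\<And>x. x \<in> W \<Longrightarrow> x \<in> carrier G" and Cc: "\<And>x. x \<in> ?C \<Longrightarrow> x \<in> carrier G"
    using W C subgroup.mem_carrier by fast+
  have "s \<otimes> x \<otimes> inv s \<in> Q \<inter> ?C" if s: "s \<in> S'" and x: "x \<in> Q \<inter> ?C" for s x
  proof -
    have sc: "s \<in> carrier G" using s Sc by blast
    have xc: "x \<in> carrier G" using x Cc by blast
    have sxQ: "s \<otimes> x \<otimes> inv s \<in> Q" using normal_invE(2)[OF Qn sc] x by blast
    \<comment> \<open>Taking \<open>w = \<one>\<close> puts \<open>s\<close> itself into a coset of
      \<open>W\<close> with representative in \<open>F s\<close>.\<close>
    obtain f0 where f0: "f0 \<in> F s" "s \<otimes> inv f0 \<in> W"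
      using F(3)[OF sc subgroup.one_closed[OF W]] sc by auto
    have f0c: "f0 \<in> carrier G" using f0 F(2) sc by blast
    \<comment> \<open>The choice of \<open>F s\<close> concerns elements of \<open>W\<close>,
      whereas \<open>x\<close> is only in the closure. So \<open>x\<close> is approximated by some
      \<open>w\<close> in \<open>W\<close> modulo a \<open>P\<close> fine enough to decide
      membership in \<open>?C\<close> for the finitely many candidates in \<open>E\<close>.\<close>
    obtain f where f: "f \<in> F s" "s \<otimes> x \<otimes> inv f \<in> ?C"
    proof -
      define E where "E = (\<lambda>f. s \<otimes> x \<otimes> inv f) ` F s"
      have "finite E" "E \<subseteq> carrier G"
        using F(1)[OF sc] F(2)[OF sc] sc xc by (auto simp: E_def)
      then obtain P where P: "normal_finite_index P G" "E \<inter> (P <#> W) \<subseteq> ?C"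
        using separate_finite_from_profinite_closure by blast
      obtain p w where pw: "p \<in> P" "w \<in> W" "x = p \<otimes> w"
        using x P(1) by (auto simp: profinite_closure_def set_mult_def)
      have Pn: "P \<lhd> G" using P(1) by (simp add: normal_finite_index_def)
      have pc: "p \<in> carrier G"
        using pw Pn normal_imp_subgroup subgroup.mem_carrier by fast
      obtain f where f: "f \<in> F s" "s \<otimes> w \<otimes> inv f \<in> W" using F(3)[OF sc pw(2)] by blast
      have fc: "f \<in> carrier G" using f F(2) sc by blast
      have "s \<otimes> x \<otimes> inv f = (s \<otimes> p \<otimes> inv s) \<otimes> (s \<otimes> w \<otimes> inv f)"
        using sc pc fc Wc[OF pw(2)] by (simp add: pw(3) m_assoc mult_inv_cancel)
      moreover have "s \<otimes> p \<otimes> inv s \<in> P" using normal_invE(2)[OF Pn sc pw(1)] .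
      ultimately have "s \<otimes> x \<otimes> inv f \<in> P <#> W"
        using f by (auto simp: set_mult_def)
      then show ?thesis using that f P(2) by (auto simp: E_def)
    qed
    have fc: "f \<in> carrier G" using f F(2) sc by blast
    have QW: "subgroup (Q <#> W) G"
      using subgroup_set_mult_normal_finite_index[OF Q W] .
    \<comment> \<open>Since \<open>s \<otimes> x \<otimes> inv s\<close> lies in \<open>Q\<close>,
      both \<open>f\<close> and \<open>f0\<close> represent \<open>s \<otimes> x\<close> modulo
      \<open>Q <#> W\<close>. The choice of \<open>Q\<close> then forces them into the same coset of
      \<open>?C\<close>, and this puts \<open>s \<otimes> x \<otimes> inv s\<close> into
      \<open>?C\<close>.\<close>
    have "s \<otimes> x \<otimes> inv f0 = (s \<otimes> x \<otimes> inv s) \<otimes> (s \<otimes> inv f0)"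
      using sc xc f0c by (simp add: m_assoc mult_inv_cancel)
    then have 1: "s \<otimes> x \<otimes> inv f0 \<in> Q <#> W"
      using sxQ f0 by (auto simp: set_mult_def)
    have 2: "inv (s \<otimes> x \<otimes> inv f) \<in> Q <#> W"
      using f(2) Q QW by (auto simp: profinite_closure_def subgroup.m_inv_closed)
    have "inv (s \<otimes> x \<otimes> inv f) \<otimes> (s \<otimes> x \<otimes> inv f0) = f \<otimes> inv f0"
      using sc xc fc f0c by (simp add: inv_mult_group m_assoc mult_inv_cancel)
    then have "f \<otimes> inv f0 \<in> Q <#> W"
      using subgroup.m_closed[OF QW 2 1] by simp
    moreover have "f \<otimes> inv f0 \<in> D" using s f f0 by (auto simp: D_def)
    ultimately have "f \<otimes> inv f0 \<in> ?C" using QD by blast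
    then have 3: "s \<otimes> x \<otimes> inv f \<otimes> (f \<otimes> inv f0) \<in> ?C"
      using f(2) subgroup.m_closed[OF C] by blast
    have "inv (s \<otimes> inv f0) \<in> ?C"
      using f0(2) profinite_closure_subset subgroup.subset[OF W] subgroup.m_inv_closed[OF C] by blast
    with 3 have "s \<otimes> x \<otimes> inv f \<otimes> (f \<otimes> inv f0) \<otimes> inv (s \<otimes> inv f0) \<in> ?C"
      using subgroup.m_closed[OF C] by blast
    also have "s \<otimes> x \<otimes> inv f \<otimes> (f \<otimes> inv f0) \<otimes> inv (s \<otimes> inv f0) = s \<otimes> x \<otimes> inv s"
      using sc xc fc f0c by (simp add: inv_mult_group m_assoc mult_inv_cancel)
    finally show ?thesis using sxQ by simp
  qed
  then have "Q \<inter> ?C \<lhd> G"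
    using normal_if_generators_normalize[OF subgroups_Inter_pair[OF Qs C] S(2,3)] by (simp add: S'_def)
  then show ?thesis using Q by blast
qed

section \<open>Residual finiteness and centralizers\<close>

text \<open>Modulo any normal \<open>Q\<close> of finite index, \<open>x\<close> agrees with an
  element of \<open>W\<close>, so the commutator of \<open>n\<close> and \<open>x\<close> lies in
  every such \<open>Q\<close>. Residual finiteness makes it trivial.\<close>

lemma profinite_closure_centralizes:
  assumes RF: "residually_finite_group G" and W: "W \<subseteq> carrier G" and n: "n \<in> carrier G"
    and cent: "\<And>w. w \<in> W \<Longrightarrow> n \<otimes> w = w \<otimes> n" and x: "x \<in> profinite_closure G W"
  shows "n \<otimes> x = x \<otimes> n"
proof (rule ccontr)
  assume neq: "n \<otimes> x \<noteq> x \<otimes> n"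
  have xc: "x \<in> carrier G" using x by (simp add: profinite_closure_def)
  define c where "c = n \<otimes> x \<otimes> inv n \<otimes> inv x"
  have cc: "c \<in> carrier G" using n xc by (simp add: c_def)
  have "c \<noteq> \<one>"
  proof
    assume "c = \<one>"
    then have "c \<otimes> (x \<otimes> n) = x \<otimes> n" using n xc by simp
    moreover have "c \<otimes> (x \<otimes> n) = n \<otimes> x"
      using n xc by (simp add: c_def m_assoc mult_inv_cancel)
    ultimately show False using neq by simp
  qed
  then obtain Q where Qn: "Q \<lhd> G" "finite (carrier (G Mod Q))" "c \<notin> Q"
    using RF cc unfolding residually_finite_group_def by blast
  then have "x \<in> Q <#> W" using x by (simp add: profinite_closure_def normal_finite_index_def)
  then obtain q w where qw: "q \<in> Q" "w \<in> W" "x = q \<otimes> w" by (auto simp: set_mult_def)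
  have Qs: "subgroup Q G" using Qn normal_imp_subgroup by blast
  have qc: "q \<in> carrier G" and wc: "w \<in> carrier G"
    using qw W subgroup.mem_carrier[OF Qs] by auto
  have "c = n \<otimes> q \<otimes> (w \<otimes> inv n \<otimes> inv w) \<otimes> inv q"
    using n qc wc by (simp add: c_def qw(3) m_assoc inv_mult_group)
  also have "w \<otimes> inv n \<otimes> inv w = inv n"
  proof -
    have "w \<otimes> inv n \<otimes> inv w = inv n \<otimes> (n \<otimes> w) \<otimes> inv n \<otimes> inv w"
      using n wc by (simp add: m_assoc mult_inv_cancel)
    then show ?thesis
      using n wc by (simp add: cent[OF qw(2)] m_assoc mult_inv_cancel)
  qed
  finally have "c = (n \<otimes> q \<otimes> inv n) \<otimes> inv q" .
  then have "c \<in> Q"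
    using normal_invE(2)[OF Qn(1) n qw(1)] subgroup.m_closed[OF Qs] subgroup.m_inv_closed[OF Qs] qw(1)
    by simp
  then show False using Qn by simp
qed

text \<open>The algebraic core, free of topology. The condition with \<open>F\<close> expresses
  commensuration: each translate of \<open>W\<close> by \<open>g\<close> on the left is covered by
  finitely many right cosets of \<open>W\<close>. The subgroup \<open>M\<close> is
  \<open>Q \<inter> profinite_closure G W\<close>, which is infinite because it contains
  \<open>Q \<inter> W\<close>.\<close>

lemma infinite_normal_centralizing:
  assumes "residually_finite_group G" "finitely_generated_group G"
    and W: "subgroup W G" "infinite W"
    and comm: "\<And>g. g \<in> carrier G \<Longrightarrow>
      \<exists>F. finite F \<and> F \<subseteq> carrier G \<and> (\<forall>w\<in>W. \<exists>f\<in>F. g \<otimes> w \<otimes> inv f \<in> W)"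
    and n: "n \<in> carrier G" "\<And>w. w \<in> W \<Longrightarrow> n \<otimes> w = w \<otimes> n"
  shows "\<exists>M. M \<lhd> G \<and> infinite M \<and> (\<forall>x\<in>M. n \<otimes> x = x \<otimes> n)"
proof -
  obtain Q where Q: "normal_finite_index Q G" "Q \<inter> profinite_closure G W \<lhd> G"
    using commensurated_virtually_normal[OF W(1)] comm assms(2)
    unfolding finitely_generated_group_def by metis
  have Wc: "W \<subseteq> carrier G" using W subgroup.subset by blast
  have "Q \<inter> W \<subseteq> Q \<inter> profinite_closure G W" using profinite_closure_subset[OF Wc] by blast
  then have "infinite (Q \<inter> profinite_closure G W)"
    using infinite_Int_normal_finite_index[OF Q(1) W] finite_subset by blast
  then show ?thesis
    using Q(2) profinite_closure_centralizes[OF assms(1) Wc n] by blast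
qed

end

section \<open>Open subgroups of topological groups and van Dantzig's theorem\<close>

context topological_group
begin

lemma continuous_map_mult:
  assumes "continuous_map S T f" "continuous_map S T g"
  shows "continuous_map S T (\<lambda>x. f x \<otimes> g x)"
proof -
  have "continuous_map S T ((\<lambda>(x, y). x \<otimes> y) \<circ> (\<lambda>x. (f x, g x)))"
    using continuous_map_compose continuous_map_pairedI[OF assms] continuous_mult by blast
  then show ?thesis by (simp add: comp_def)
qed

lemma continuous_map_l_mult: "g \<in> carrier G \<Longrightarrow> continuous_map T T (\<lambda>x. g \<otimes> x)"
  using topspace_eq by (auto intro!: continuous_map_mult)

lemma continuous_map_r_mult: "g \<in> carrier G \<Longrightarrow> continuous_map T T (\<lambda>x. x \<otimes> g)"
  using topspace_eq by (auto intro!: continuous_map_mult)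

lemma openin_r_coset:
  assumes U: "openin T U" and g: "g \<in> carrier G"
  shows "openin T (U #> g)"
proof -
  have Uc: "U \<subseteq> carrier G" using openin_subset[OF U] topspace_eq by simp
  have "U #> g = {x \<in> topspace T. x \<otimes> inv g \<in> U}"
    using Uc g topspace_eq by (force simp: r_coset_def m_assoc)
  then show ?thesis
    using openin_continuous_map_preimage[OF continuous_map_r_mult[OF inv_closed[OF g]] U] by simp
qed

lemma openin_l_translate_preimage:
  assumes U: "openin T U" and g: "g \<in> carrier G"
  shows "openin T {x \<in> carrier G. g \<otimes> x \<in> U}"
  using openin_continuous_map_preimage[OF continuous_map_l_mult[OF g] U] topspace_eq by simp

lemma openin_subgroup_if_contains_open:
  assumes H: "subgroup H G" and V: "openin T V" "\<one> \<in> V" "V \<subseteq> H"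
  shows "openin T H"
proof (subst openin_subopen, intro ballI)
  fix h assume h: "h \<in> H"
  have hc: "h \<in> carrier G" using h H subgroup.mem_carrier by fast
  have "h \<in> V #> h" using V hc by (force simp: r_coset_def)
  moreover have "V #> h \<subseteq> H" using V h H by (auto simp: r_coset_def subgroup.m_closed)
  ultimately show "\<exists>S. openin T S \<and> h \<in> S \<and> S \<subseteq> H" using openin_r_coset[OF V(1) hc] by blast
qed

text \<open>A coset of \<open>H\<close> through a point outside \<open>H\<close> misses
  \<open>H\<close>, so the complement is a union of open cosets.\<close>

lemma closedin_open_subgroup:
  assumes H: "subgroup H G" and op: "openin T H"
  shows "closedin T H"
proof -
  have Hc: "H \<subseteq> carrier G" using H subgroup.subset by blast
  have "openin T (carrier G - H)"
  proof (subst openin_subopen, intro ballI)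
    fix x assume x: "x \<in> carrier G - H"
    have "x \<in> H #> x" using x H by (simp add: rcos_self)
    moreover have "H #> x \<subseteq> carrier G - H"
    proof
      fix y assume "y \<in> H #> x"
      then obtain h where h: "h \<in> H" "y = h \<otimes> x" by (auto simp: r_coset_def)
      have "y \<notin> H"
      proof
        assume "y \<in> H"
        then have "inv h \<otimes> y \<in> H" using h H by (simp add: subgroup.m_closed subgroup.m_inv_closed)
        then show False using h x Hc by (auto simp: mult_inv_cancel subset_iff)
      qed
      then show "y \<in> carrier G - H" using h x Hc by auto
    qed
    ultimately show "\<exists>S. openin T S \<and> x \<in> S \<and> S \<subseteq> carrier G - H"
      using openin_r_coset[OF op] x by blast
  qed
  then show ?thesis using Hc by (simp add: closedin_def topspace_eq)
qed

text \<open>Inside \<open>V\<close> there is a compact open neighbourhood \<open>A\<close> of the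
  identity, and its stabilizer under left translation is an open subgroup contained in
  \<open>A\<close>.\<close>

theorem van_Dantzig:
  assumes LC: "locally_compact_space T" and Hd: "Hausdorff_space T"
    and td: "totally_disconnected_space T"
    and V: "openin T V" "\<one> \<in> V"
  shows "\<exists>U. subgroup U G \<and> openin T U \<and> compactin T U \<and> U \<subseteq> V"
proof -
  obtain O' K where OK: "openin T O'" "compactin T K" "\<one> \<in> O'" "O' \<subseteq> K" "K \<subseteq> V"
    using LC V Hd unfolding locally_compact_space_neighbourhood_base[OF disjI1[OF Hd]]
    by (metis neighbourhood_base_of)
  have one: "\<one> \<in> topspace T" by (simp add: topspace_eq)
  \<comment> \<open>The component of the identity is a single point, so it can be cut off by a
    clopen set \<open>A\<close> inside \<open>O'\<close>. As \<open>O'\<close> lies in the compact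
    set \<open>K\<close>, this \<open>A\<close> is compact.\<close>
  have "{\<one>} \<in> connected_components_of T"
    using td one unfolding totally_disconnected_space_def connected_components_of_def by blast
  then obtain A B where AB: "openin T A" "openin T B" "disjnt A B" "A \<union> B = topspace T"
      "\<one> \<in> A" "A \<subseteq> O'"
    using wilder_locally_compact_component_thm[OF LC Hd, of "{\<one>}" O'] OK one by auto
  have "A = topspace T - B" using AB by (auto simp: disjnt_iff)
  then have "closedin T A" using AB by blast
  then have cA: "compactin T A" using closed_compactin OK AB by blast
  have Ac: "A \<subseteq> carrier G" using AB topspace_eq by blast
  \<comment> \<open>The two inclusions together say that left translation by \<open>g\<close> maps
    \<open>A\<close> onto itself; stating both makes closure under inverses immediate.\<close>
  define U where "U = {g \<in> carrier G. \<forall>a\<in>A. g \<otimes> a \<in> A \<and> inv g \<otimes> a \<in> A}"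
  have U: "subgroup U G"
  proof (rule subgroupI)
    show "U \<subseteq> carrier G" by (auto simp: U_def)
    have "\<one> \<in> U" using Ac by (auto simp: U_def)
    then show "U \<noteq> {}" by blast
    show "inv a \<in> U" if "a \<in> U" for a using that by (auto simp: U_def)
    show "a \<otimes> b \<in> U" if ab: "a \<in> U" "b \<in> U" for a b
    proof -
      have "a \<otimes> b \<otimes> x = a \<otimes> (b \<otimes> x)" "inv (a \<otimes> b) \<otimes> x = inv b \<otimes> (inv a \<otimes> x)" if "x \<in> A" for x
        using that ab Ac by (auto simp: U_def m_assoc inv_mult_group subset_iff)
      then show ?thesis using ab by (auto simp: U_def)
    qed
  qed
  have "U \<subseteq> A" using AB by (force simp: U_def)
  have op: "openin T U"
  proof -
    let ?W = "{p \<in> topspace (prod_topology T T). (case p of (x, y) \<Rightarrow> x \<otimes> y) \<in> A}"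
    have W: "openin (prod_topology T T) ?W"
      using openin_continuous_map_preimage[OF continuous_mult AB(1)] .
    \<comment> \<open>Compactness of \<open>A\<close> enters through the tube lemma: it gives one
      neighbourhood \<open>P\<close> of the identity whose elements all translate \<open>A\<close>
      into \<open>A\<close>. Its symmetric part \<open>?X\<close> then lies in
      \<open>U\<close>.\<close>
    have "{\<one>} \<times> A \<subseteq> ?W" using Ac by (auto simp: topspace_eq)
    then obtain P Y where XY: "openin T P" "openin T Y" "\<one> \<in> P" "A \<subseteq> Y" "P \<times> Y \<subseteq> ?W"
      using tube_lemma_right[OF W cA one] by blast
    have XA: "x \<otimes> a \<in> A" if "x \<in> P" "a \<in> A" for x a
    proof -
      have "(x, a) \<in> P \<times> Y" using that XY(4) by blast
      then show ?thesis using XY(5) by auto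
    qed
    let ?X = "P \<inter> {x \<in> topspace T. inv x \<in> P}"
    have "openin T ?X"
      using XY openin_continuous_map_preimage[OF continuous_inv XY(1)] by blast
    moreover have "\<one> \<in> ?X" using XY one by simp
    moreover have "?X \<subseteq> U" using XA topspace_eq by (auto simp: U_def)
    ultimately show ?thesis using openin_subgroup_if_contains_open[OF U] by blast
  qed
  have "compactin T U"
    using closed_compactin[OF cA \<open>U \<subseteq> A\<close> closedin_open_subgroup[OF U op]] .
  then show ?thesis using U op \<open>U \<subseteq> A\<close> AB OK by blast
qed

section \<open>Compact open subgroups, dense subgroups and discrete normal subgroups\<close>

text \<open>The translate of \<open>U\<close> by \<open>g\<close> is compact, so finitely many of
  the open right cosets of \<open>U\<close> cover it. Representatives are needed in
  \<open>\<Gamma>\<close>, so that \<open>\<Gamma> \<inter> U\<close> becomes commensurated in the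
  abstract group \<open>\<Gamma>\<close>.\<close>

lemma compact_open_subgroup_commensurated:
  assumes U: "subgroup U G" "openin T U" "compactin T U" and g: "g \<in> carrier G"
    and \<Gamma>: "subgroup \<Gamma> G"
  shows "\<exists>F. finite F \<and> F \<subseteq> \<Gamma> \<and> (\<forall>w\<in>U. g \<otimes> w \<in> \<Gamma> \<longrightarrow> (\<exists>f\<in>F. g \<otimes> w \<otimes> inv f \<in> U))"
proof -
  have Uc: "U \<subseteq> carrier G" using U subgroup.subset by blast
  define gU where "gU = (\<lambda>x. g \<otimes> x) ` U"
  define \<C> where "\<C> = (\<lambda>h. U #> h) ` carrier G"
  have "compactin T gU"
    unfolding gU_def using image_compactin[OF U(3) continuous_map_l_mult[OF g]] .
  moreover have "openin T C" if "C \<in> \<C>" for C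
    using that openin_r_coset[OF U(2)] by (auto simp: \<C>_def)
  moreover have "gU \<subseteq> \<Union>\<C>"
  proof
    fix y assume "y \<in> gU"
    then have "y \<in> carrier G" using Uc g by (auto simp: gU_def)
    then show "y \<in> \<Union>\<C>" using rcos_self[OF _ U(1)] by (auto simp: \<C>_def)
  qed
  ultimately obtain \<F> where \<F>: "finite \<F>" "\<F> \<subseteq> \<C>" "gU \<subseteq> \<Union>\<F>"
    using compactinD by metis
  obtain H where H: "finite H" "H \<subseteq> carrier G" "\<F> = (\<lambda>h. U #> h) ` H"
    using finite_subset_image[OF \<F>(1,2)[unfolded \<C>_def]] by auto
  \<comment> \<open>Only cosets that meet \<open>\<Gamma>\<close> matter for products
    \<open>g \<otimes> w\<close> in \<open>\<Gamma>\<close>, and for these the representative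
    \<open>h\<close> can be replaced by an element \<open>r h\<close> of
    \<open>\<Gamma>\<close>.\<close>
  define H' where "H' = {h \<in> H. (U #> h) \<inter> \<Gamma> \<noteq> {}}"
  define r where "r h = (SOME y. y \<in> (U #> h) \<inter> \<Gamma>)" for h
  have r: "r h \<in> (U #> h) \<inter> \<Gamma>" if "h \<in> H'" for h
    unfolding r_def by (rule someI_ex) (use that in \<open>auto simp: H'_def\<close>)
  have "\<exists>f\<in>r ` H'. g \<otimes> w \<otimes> inv f \<in> U" if w: "w \<in> U" "g \<otimes> w \<in> \<Gamma>" for w
  proof -
    obtain h where h: "h \<in> H" "g \<otimes> w \<in> U #> h"
      using \<F>(3) w(1) by (auto simp: gU_def H(3))
    have h': "h \<in> H'" using h w by (auto simp: H'_def)
    have hc: "h \<in> carrier G" using h(1) H(2) by blast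
    obtain u where u: "u \<in> U" "g \<otimes> w = u \<otimes> h" using h(2) by (auto simp: r_coset_def)
    obtain v where v: "v \<in> U" "r h = v \<otimes> h" using r[OF h'] by (auto simp: r_coset_def)
    have "g \<otimes> w \<otimes> inv (r h) = u \<otimes> inv v"
    proof -
      have "u \<in> carrier G" "v \<in> carrier G" using u v Uc by auto
      then show ?thesis using u(2) v(2) hc by (simp add: inv_mult_group m_assoc mult_inv_cancel)
    qed
    then have "g \<otimes> w \<otimes> inv (r h) \<in> U"
      using u v U(1) by (simp add: subgroup.m_closed subgroup.m_inv_closed)
    then show ?thesis using h' by blast
  qed
  moreover have "finite (r ` H')" "r ` H' \<subseteq> \<Gamma>" using H(1) r by (auto simp: H'_def)
  ultimately show ?thesis by blast
qed

lemma discrete_if_open_singleton: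
  assumes "openin T {\<one>}"
  shows "T = discrete_topology (carrier G)"
proof -
  have "openin T {x}" if "x \<in> carrier G" for x
    using openin_r_coset[OF assms that] that by (simp add: r_coset_def)
  then show ?thesis
    using topspace_eq by (metis discrete_topology_unique)
qed

text \<open>If the intersection were finite, deleting its points other than \<open>\<one>\<close>
  from \<open>U\<close> would leave an open set. Deleting \<open>\<one>\<close> too leaves an open
  set disjoint from \<open>\<Gamma>\<close>, hence empty by density. So \<open>{\<one>}\<close>
  would be open and \<open>T\<close> discrete.\<close>

lemma infinite_open_Int_dense:
  assumes Hd: "Hausdorff_space T" and nd: "T \<noteq> discrete_topology (carrier G)"
    and dense: "T closure_of \<Gamma> = topspace T" and U: "openin T U" "\<one> \<in> U"
  shows "infinite (\<Gamma> \<inter> U)"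
proof
  assume fin: "finite (\<Gamma> \<inter> U)"
  have "closedin T (\<Gamma> \<inter> U - {\<one>})"
    using fin U openin_subset Hausdorff_imp_t1_space[OF Hd]
    by (auto simp: t1_space_closedin_finite dest!: openin_subset)
  then have V: "openin T (U - (\<Gamma> \<inter> U - {\<one>}))" using U by blast
  have "closedin T {\<one>}"
    using closedin_Hausdorff_singleton[OF Hd] topspace_eq by simp
  then have "openin T (U - (\<Gamma> \<inter> U - {\<one>}) - {\<one>})" using V by blast
  moreover have "\<Gamma> \<inter> (U - (\<Gamma> \<inter> U - {\<one>}) - {\<one>}) = {}" by blast
  ultimately have "U - (\<Gamma> \<inter> U - {\<one>}) - {\<one>} = {}"
    using dense by (metis dense_intersects_open inf_commute)
  then have "U - (\<Gamma> \<inter> U - {\<one>}) = {\<one>}" using U by blast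
  then show False using V nd discrete_if_open_singleton by simp
qed

text \<open>An open \<open>V\<close> isolates \<open>n\<close> within \<open>N\<close>. Conjugates
  of \<open>n\<close> stay in \<open>N\<close>, so such a conjugate lies in \<open>V\<close> only if
  it equals \<open>n\<close>; the centralizer is thus the preimage of \<open>V\<close> under the
  orbit map.\<close>

lemma openin_centralizer_discrete_normal:
  assumes N: "N \<lhd> G" "subtopology T N = discrete_topology N" and n: "n \<in> N"
  shows "openin T (centralizer G {n})"
proof -
  have nc: "n \<in> carrier G"
    using n N normal_imp_subgroup subgroup.mem_carrier by fast
  have "openin (subtopology T N) {n}" using N n by simp
  then obtain V where V: "openin T V" "{n} = V \<inter> N" by (auto simp: openin_subtopology)
  have "continuous_map T T (\<lambda>g. g \<otimes> n \<otimes> inv g)"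
    using nc topspace_eq by (auto intro!: continuous_map_mult continuous_inv)
  then have "openin T {g \<in> topspace T. g \<otimes> n \<otimes> inv g \<in> V}"
    using V openin_continuous_map_preimage by blast
  moreover have "{g \<in> topspace T. g \<otimes> n \<otimes> inv g \<in> V} = centralizer G {n}"
  proof -
    have "g \<otimes> n \<otimes> inv g \<in> V \<longleftrightarrow> g \<otimes> n = n \<otimes> g" if g: "g \<in> carrier G" for g
    proof -
      have "g \<otimes> n \<otimes> inv g \<in> V \<longleftrightarrow> g \<otimes> n \<otimes> inv g = n"
        using V normal_invE(2)[OF N(1) g n] by blast
      also have "\<dots> \<longleftrightarrow> g \<otimes> n = n \<otimes> g"
        using g nc inv_solve_right' by (metis m_closed)
      finally show ?thesis .
    qed
    then show ?thesis by (auto simp: centralizer_def topspace_eq)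
  qed
  ultimately show ?thesis by simp
qed

end

section \<open>Centralizers as subgroups and as normal subgroups\<close>

lemma (in group) subgroup_centralizer:
  assumes "A \<subseteq> carrier G"
  shows "subgroup (centralizer G A) G"
proof (rule subgroupI)
  show "centralizer G A \<subseteq> carrier G" by (auto simp: centralizer_def)
  have "\<one> \<in> centralizer G A" using assms by (auto simp: centralizer_def)
  then show "centralizer G A \<noteq> {}" by blast
  show "inv a \<in> centralizer G A" if a: "a \<in> centralizer G A" for a
  proof -
    have "inv a \<otimes> x = x \<otimes> inv a" if "x \<in> A" for x
    proof -
      have "a \<otimes> x = x \<otimes> a" "a \<in> carrier G" "x \<in> carrier G"
        using a that assms by (auto simp: centralizer_def)
      then show ?thesis by (metis inv_closed inv_solve_left inv_solve_right m_assoc m_closed)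
    qed
    then show ?thesis using a by (simp add: centralizer_def)
  qed
  show "a \<otimes> b \<in> centralizer G A" if ab: "a \<in> centralizer G A" "b \<in> centralizer G A" for a b
  proof -
    have "a \<otimes> b \<otimes> x = x \<otimes> (a \<otimes> b)" if "x \<in> A" for x
    proof -
      have "a \<otimes> x = x \<otimes> a" "b \<otimes> x = x \<otimes> b" "a \<in> carrier G" "b \<in> carrier G" "x \<in> carrier G"
        using ab that assms by (auto simp: centralizer_def)
      then show ?thesis by (metis m_assoc)
    qed
    then show ?thesis using ab by (simp add: centralizer_def)
  qed
qed

lemma (in group) normal_centralizer_conjugation_invariant:
  assumes A: "A \<subseteq> carrier G"
    and conj: "\<And>g a. g \<in> carrier G \<Longrightarrow> a \<in> A \<Longrightarrow> g \<otimes> a \<otimes> inv g \<in> A"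
  shows "centralizer G A \<lhd> G"
proof (rule normal_invI[OF subgroup_centralizer[OF A]])
  fix g c assume g: "g \<in> carrier G" and c: "c \<in> centralizer G A"
  have cc: "c \<in> carrier G" using c by (simp add: centralizer_def)
  have "g \<otimes> c \<otimes> inv g \<otimes> a = a \<otimes> (g \<otimes> c \<otimes> inv g)" if a: "a \<in> A" for a
  proof -
    have ac: "a \<in> carrier G" using a A by blast
    have "inv g \<otimes> a \<otimes> g \<in> A" using conj[of "inv g" a] g a by simp
    then have *: "c \<otimes> (inv g \<otimes> a \<otimes> g) = inv g \<otimes> a \<otimes> g \<otimes> c" using c by (simp add: centralizer_def)
    have "g \<otimes> c \<otimes> inv g \<otimes> a = g \<otimes> (c \<otimes> (inv g \<otimes> a \<otimes> g)) \<otimes> inv g"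
      using g cc ac by (simp add: m_assoc)
    also have "\<dots> = a \<otimes> (g \<otimes> c \<otimes> inv g)"
      unfolding * using g cc ac by (simp add: m_assoc mult_inv_cancel)
    finally show ?thesis .
  qed
  then show "g \<otimes> c \<otimes> inv g \<in> centralizer G A" using g cc by (simp add: centralizer_def)
qed

section \<open>Discrete normal subgroups contained in a dense subgroup\<close>

theorem corollary22:
  fixes G :: "('a, 'b) monoid_scheme" (structure)
    and T :: "'a topology"
    and \<Gamma> :: "'a set"
  assumes "locally_compact_group G T"
    and "totally_disconnected_space T"
    and "T \<noteq> discrete_topology (carrier G)"
    and "\<And>N. N \<lhd> G \<Longrightarrow> infinite N \<Longrightarrow> centralizer G N = {\<one>}"
    and "subgroup \<Gamma> G"
    and "T closure_of \<Gamma> = topspace T"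
    and "finitely_generated_group (G\<lparr>carrier := \<Gamma>\<rparr>)"
    and "residually_finite_group (G\<lparr>carrier := \<Gamma>\<rparr>)"
  shows "\<forall>N. N \<lhd> G \<and> subtopology T N = discrete_topology N \<and> N \<subseteq> \<Gamma> \<longleftrightarrow> N = {\<one>}"
proof -
  interpret topological_group G T
    using assms(1) by (simp add: locally_compact_group_def)
  have Hd: "Hausdorff_space T" and LC: "locally_compact_space T"
    using assms(1) by (auto simp: locally_compact_group_def)
  let ?H = "G\<lparr>carrier := \<Gamma>\<rparr>"
  interpret H: group ?H using assms(5) by (rule subgroup_imp_group)
  have \<Gamma>c: "\<And>x. x \<in> \<Gamma> \<Longrightarrow> x \<in> carrier G" using assms(5) subgroup.mem_carrier by fast
  have inv_eq: "inv\<^bsub>?H\<^esub> x = inv x" if "x \<in> \<Gamma>" for x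
    using m_inv_consistent[OF assms(5) that] .
  have "n = \<one>"
    if N: "N \<lhd> G" "subtopology T N = discrete_topology N" "N \<subseteq> \<Gamma>" and n: "n \<in> N" for N n
  proof -
    have n\<Gamma>: "n \<in> \<Gamma>" using N n by blast
    then have nc: "n \<in> carrier G" using \<Gamma>c by blast
    let ?Z = "centralizer G {n}"
    have Zs: "subgroup ?Z G" using subgroup_centralizer nc by simp
    have Zo: "openin T ?Z" using openin_centralizer_discrete_normal N n by blast
    obtain U where U: "subgroup U G" "openin T U" "compactin T U" "U \<subseteq> ?Z"
      using van_Dantzig[OF LC Hd assms(2) Zo subgroup.one_closed[OF Zs]] by blast
    \<comment> \<open>The topology is left behind here: the algebraic result is applied in the
      abstract group \<open>?H\<close> to \<open>\<Gamma> \<inter> U\<close>, which commutes with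
      \<open>n\<close> because \<open>U\<close> lies in \<open>?Z\<close>.\<close>
    have "\<exists>M. M \<lhd> ?H \<and> infinite M \<and> (\<forall>x\<in>M. n \<otimes>\<^bsub>?H\<^esub> x = x \<otimes>\<^bsub>?H\<^esub> n)"
    proof (rule H.infinite_normal_centralizing[OF assms(8,7)])
      show "subgroup (\<Gamma> \<inter> U) ?H"
        using subgroup_incl[OF subgroups_Inter_pair[OF assms(5) U(1)] assms(5)] by simp
      show "infinite (\<Gamma> \<inter> U)"
        using infinite_open_Int_dense[OF Hd assms(3,6) U(2)] subgroup.one_closed[OF U(1)] by simp
      show "n \<in> carrier ?H" using n\<Gamma> by simp
      show "n \<otimes>\<^bsub>?H\<^esub> w = w \<otimes>\<^bsub>?H\<^esub> n" if "w \<in> \<Gamma> \<inter> U" for w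
        using that U(4) by (auto simp: centralizer_def)
      show "\<exists>F. finite F \<and> F \<subseteq> carrier ?H \<and>
          (\<forall>w\<in>\<Gamma> \<inter> U. \<exists>f\<in>F. g \<otimes>\<^bsub>?H\<^esub> w \<otimes>\<^bsub>?H\<^esub> inv\<^bsub>?H\<^esub> f \<in> \<Gamma> \<inter> U)"
        if g: "g \<in> carrier ?H" for g
      proof -
        have g\<Gamma>: "g \<in> \<Gamma>" using g by simp
        obtain F where F: "finite F" "F \<subseteq> \<Gamma>"
            "\<And>w. w \<in> U \<Longrightarrow> g \<otimes> w \<in> \<Gamma> \<Longrightarrow> \<exists>f\<in>F. g \<otimes> w \<otimes> inv f \<in> U"
          using compact_open_subgroup_commensurated[OF U(1-3) \<Gamma>c[OF g\<Gamma>] assms(5)] by blast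
        have "\<forall>w\<in>\<Gamma> \<inter> U. \<exists>f\<in>F. g \<otimes> w \<otimes> inv\<^bsub>?H\<^esub> f \<in> \<Gamma> \<inter> U"
        proof
          fix w assume w: "w \<in> \<Gamma> \<inter> U"
          have gw: "g \<otimes> w \<in> \<Gamma>" using subgroup.m_closed[OF assms(5) g\<Gamma>] w by blast
          then obtain f where f: "f \<in> F" "g \<otimes> w \<otimes> inv f \<in> U" using F(3) w by blast
          have "g \<otimes> w \<otimes> inv f \<in> \<Gamma>"
            using gw f F(2) subgroup.m_closed[OF assms(5)] subgroup.m_inv_closed[OF assms(5)] by blast
          moreover have "inv\<^bsub>?H\<^esub> f = inv f" using inv_eq f(1) F(2) by blast
          ultimately show "\<exists>f\<in>F. g \<otimes> w \<otimes> inv\<^bsub>?H\<^esub> f \<in> \<Gamma> \<inter> U"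
            using f by (intro bexI[of _ f]) simp_all
        qed
        then show ?thesis using F(1,2) by (intro exI[of _ F] conjI) simp_all
      qed
    qed
    then obtain M where M: "M \<lhd> ?H" "infinite M"
        and "\<forall>x\<in>M. n \<otimes>\<^bsub>?H\<^esub> x = x \<otimes>\<^bsub>?H\<^esub> n" by blast
    then have Mn: "n \<otimes> x = x \<otimes> n" if "x \<in> M" for x using that by simp
    have M\<Gamma>: "\<And>x. x \<in> M \<Longrightarrow> x \<in> \<Gamma>"
      using subgroup.subset[OF normal_imp_subgroup[OF M(1)]] by auto
    \<comment> \<open>\<open>M\<close> is normal in \<open>\<Gamma>\<close> only, while the
      hypothesis on centralizers needs a normal subgroup of \<open>G\<close>. The centralizer of the
      full conjugacy class \<open>A\<close> of \<open>n\<close> is one, and it is infinite once it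
      is shown to contain \<open>M\<close>.\<close>
    define A where "A = (\<lambda>g. g \<otimes> n \<otimes> inv g) ` carrier G"
    have Ac: "A \<subseteq> carrier G" using nc by (auto simp: A_def)
    have "g \<otimes> a \<otimes> inv g \<in> A" if g: "g \<in> carrier G" and a: "a \<in> A" for g a
    proof -
      obtain h where h: "h \<in> carrier G" "a = h \<otimes> n \<otimes> inv h" using a by (auto simp: A_def)
      have "g \<otimes> a \<otimes> inv g = (g \<otimes> h) \<otimes> n \<otimes> inv (g \<otimes> h)"
        using g h nc by (simp add: m_assoc inv_mult_group)
      then show ?thesis using g h by (simp add: A_def)
    qed
    then have D: "centralizer G A \<lhd> G"
      by (rule normal_centralizer_conjugation_invariant[OF Ac])
    have "M \<subseteq> centralizer G A"
    proof
      fix x assume x: "x \<in> M"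
      have xc: "x \<in> carrier G" using x M\<Gamma> \<Gamma>c by blast
      have "x \<otimes> a = a \<otimes> x" if "a \<in> A" for a
      proof -
        obtain g where g: "g \<in> carrier G" "a = g \<otimes> n \<otimes> inv g" using \<open>a \<in> A\<close> by (auto simp: A_def)
        \<comment> \<open>As the centralizer of \<open>n\<close> is open, density gives every conjugate of \<open>n\<close> already over \<open>\<Gamma>\<close>.\<close>
        define Y where "Y = {y \<in> carrier G. inv g \<otimes> y \<in> ?Z}"
        have "openin T Y"
          using openin_l_translate_preimage[OF Zo inv_closed[OF g(1)]] by (simp add: Y_def)
        moreover have "g \<in> Y"
          using g(1) subgroup.one_closed[OF Zs] by (simp add: Y_def)
        ultimately have "\<Gamma> \<inter> Y \<noteq> {}"
          using dense_intersects_open[of T \<Gamma>] assms(6) by blast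
        then obtain y where y: "y \<in> \<Gamma>" "inv g \<otimes> y \<in> ?Z" by (auto simp: Y_def)
        have yc: "y \<in> carrier G" using y \<Gamma>c by blast
        have "inv g \<otimes> y \<otimes> n = n \<otimes> (inv g \<otimes> y)" using y by (simp add: centralizer_def)
        then have "g \<otimes> (inv g \<otimes> y \<otimes> n) \<otimes> inv y = g \<otimes> (n \<otimes> (inv g \<otimes> y)) \<otimes> inv y" by simp
        then have a: "a = y \<otimes> n \<otimes> inv y"
          using g yc nc by (simp add: m_assoc mult_inv_cancel)
        have iy: "inv y \<in> \<Gamma>" using subgroup.m_inv_closed[OF assms(5) y(1)] .
        \<comment> \<open>Normality of \<open>M\<close> in \<open>\<Gamma>\<close> suffices because
          \<open>y\<close> is in \<open>\<Gamma>\<close>: the conjugate of \<open>x\<close> by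
          \<open>inv y\<close> commutes with \<open>n\<close>, and conjugating back by
          \<open>y\<close> shows that \<open>x\<close> commutes with \<open>a\<close>.\<close>
        have "inv y \<otimes> x \<otimes> inv\<^bsub>?H\<^esub> (inv y) \<in> M"
          using H.normal_invE(2)[OF M(1) _ x, of "inv y"] iy by simp
        then have "inv y \<otimes> x \<otimes> y \<in> M" unfolding inv_eq[OF iy] using yc by simp
        then have *: "n \<otimes> (inv y \<otimes> x \<otimes> y) = inv y \<otimes> x \<otimes> y \<otimes> n" by (rule Mn)
        have "a \<otimes> x = y \<otimes> (n \<otimes> (inv y \<otimes> x \<otimes> y)) \<otimes> inv y"
          using yc nc xc by (simp add: a m_assoc)
        also have "\<dots> = x \<otimes> a"
          unfolding * using yc nc xc by (simp add: a m_assoc mult_inv_cancel)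
        finally show ?thesis by simp
      qed
      then show "x \<in> centralizer G A" using xc by (simp add: centralizer_def)
    qed
    then have "infinite (centralizer G A)" using M(2) finite_subset by blast
    \<comment> \<open>Being a member of \<open>A\<close>, \<open>n\<close> commutes with everything
      that centralizes \<open>A\<close>, so it lies in this double centralizer.\<close>
    then have "centralizer G (centralizer G A) = {\<one>}" using assms(4) D by blast
    moreover have "n \<in> A" unfolding A_def using nc by (intro image_eqI[of _ _ \<one>]) simp_all
    then have "n \<in> centralizer G (centralizer G A)" using nc by (auto simp: centralizer_def)
    ultimately show ?thesis by blast
  qed
  moreover have "\<one> \<in> N" if "N \<lhd> G" for N
    using that normal_imp_subgroup subgroup.one_closed by blast
  ultimately have "N = {\<one>}"
    if "N \<lhd> G" "subtopology T N = discrete_topology N" "N \<subseteq> \<Gamma>" for N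
    using that by (intro equalityI subsetI) auto
  moreover have "{\<one>} \<lhd> G" "{\<one>} \<subseteq> \<Gamma>"
    using one_is_normal subgroup.one_closed[OF assms(5)] by auto
  moreover have "subtopology T {\<one>} = discrete_topology {\<one>}"
    by (simp add: topspace_eq subtopology_eq_discrete_topology_sing)
  ultimately show ?thesis by metis
qed

end
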